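(* Let $\hat{\mathcal{P}}$ be a finite protocol instance, $\mathsf{s}$ one of its sorts, and $\varphi$ a quantifier-free clause such that $0<\#(\varphi,\mathsf{s})<|\mathsf{s}|$. Let $c_1,\dots,c_n$ ($n=\#(\varphi,\mathsf{s})$) be the distinct constants of $\mathsf{s}$ occurring in $\varphi$, let $\widehat{\varphi}$ be obtained from $\varphi$ by replacing each $c_i$ by a variable $V_i$ of sort $\mathsf{s}$, and let $$\Phi(\mathsf{s})=\forall V_1,\dots,V_n\in\mathsf{s}:\ (\mathrm{distinct}\ V_1\dots V_n)\to\widehat{\varphi}.$$ Then $\Phi(\mathsf{s})$ is logically equivalent to $\varphi^{L(Sym(\mathsf{s}))}=\bigwedge_{\gamma\in Sym(\mathsf{s})}\varphi^{\gamma}$.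
   Context: A finite protocol instance has finitely many sorts, each a finite set of distinct constants; state variables are Boolean variables $r(c_1,\dots,c_k)$ obtained by instantiating protocol relations with sort constants, and a clause is a disjunction of literals over them. $Sym(\mathsf{s})$ is the symmetric group on the constants of sort $\mathsf{s}$; for $\gamma\in Sym(\mathsf{s})$, $\varphi^{\gamma}$ is obtained by replacing each constant $c$ of $\mathsf{s}$ in $\varphi$ by $\gamma(c)$. $\#(\varphi,\mathsf{s})$ denotes the number of distinct constants of sort $\mathsf{s}$ that occur in $\varphi$, and $|\mathsf{s}|$ is the number of constants of $\mathsf{s}$. $(\mathrm{distinct}\ V_1\dots V_n)$ asserts that the $V_i$ take pairwise different values. *)

theory Defs
  imports Main "HOL-Library.Disjoint_Sets" "HOL-Combinatorics.Permutations"
begin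

text \<open>
  The vocabulary of a protocol instance. The constants of all sorts live in one type \<open>'c\<close>;
  \<open>arg_sorts r\<close> lists the sorts of the arguments of the relation \<open>r\<close>.
\<close>

record ('s, 'r, 'c) protocol_instance =
  sorts :: "'s set"
  constants :: "'s \<Rightarrow> 'c set"
  relations :: "'r set"
  arg_sorts :: "'r \<Rightarrow> 's list"

text \<open>
  Disjointness of the sorts expresses that each constant has exactly one sort, so that renaming
  the constants of one sort cannot touch an argument position of another sort.
\<close>

definition finite_instance :: "('s, 'r, 'c) protocol_instance \<Rightarrow> bool" where
  "finite_instance P \<longleftrightarrow>
     finite (sorts P) \<and>
     (\<forall>s\<in>sorts P. finite (constants P s)) \<and>
     disjoint_family_on (constants P) (sorts P) \<and>
     (\<forall>r\<in>relations P. set (arg_sorts P r) \<subseteq> sorts P)"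

definition state_vars :: "('s, 'r, 'c) protocol_instance \<Rightarrow> ('r \<times> 'c list) set" where
  "state_vars P =
     {(r, cs). r \<in> relations P \<and> list_all2 (\<lambda>c s. c \<in> constants P s) cs (arg_sorts P r)}"

datatype (trm_consts: 'c) trm = Const 'c | Var nat

datatype ('s, 'r, fm_consts: 'c) fm =
    Atom 'r "'c trm list"
  | Distinct "'c trm list"
  | Neg "('s, 'r, 'c) fm"
  | Conj "('s, 'r, 'c) fm list"
  | Disj "('s, 'r, 'c) fm list"
  | Imp "('s, 'r, 'c) fm" "('s, 'r, 'c) fm"
  | Forall nat 's "('s, 'r, 'c) fm"

fun trm_val :: "(nat \<Rightarrow> 'c) \<Rightarrow> 'c trm \<Rightarrow> 'c" where
  "trm_val \<sigma> (Const c) = c"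
| "trm_val \<sigma> (Var v) = \<sigma> v"

text \<open>
  A state \<open>M\<close> gives a truth value to every state variable; its values on pairs that are not state
  variables are irrelevant for well-sorted formulas. Every constant denotes itself, and
  quantifiers range over the constants of their sort.
\<close>

fun sat :: "('s, 'r, 'c) protocol_instance \<Rightarrow> ('r \<times> 'c list \<Rightarrow> bool) \<Rightarrow> (nat \<Rightarrow> 'c)
    \<Rightarrow> ('s, 'r, 'c) fm \<Rightarrow> bool" where
  "sat P M \<sigma> (Atom r ts) \<longleftrightarrow> M (r, map (trm_val \<sigma>) ts)"
| "sat P M \<sigma> (Distinct ts) \<longleftrightarrow> distinct (map (trm_val \<sigma>) ts)"
| "sat P M \<sigma> (Neg f) \<longleftrightarrow> \<not> sat P M \<sigma> f"
| "sat P M \<sigma> (Conj fs) \<longleftrightarrow> (\<forall>f\<in>set fs. sat P M \<sigma> f)"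
| "sat P M \<sigma> (Disj fs) \<longleftrightarrow> (\<exists>f\<in>set fs. sat P M \<sigma> f)"
| "sat P M \<sigma> (Imp f g) \<longleftrightarrow> (sat P M \<sigma> f \<longrightarrow> sat P M \<sigma> g)"
| "sat P M \<sigma> (Forall v s f) \<longleftrightarrow> (\<forall>c\<in>constants P s. sat P M (\<sigma>(v := c)) f)"

definition logically_equivalent ::
    "('s, 'r, 'c) protocol_instance \<Rightarrow> ('s, 'r, 'c) fm \<Rightarrow> ('s, 'r, 'c) fm \<Rightarrow> bool" where
  "logically_equivalent P f g \<longleftrightarrow> (\<forall>M \<sigma>. sat P M \<sigma> f \<longleftrightarrow> sat P M \<sigma> g)"

definition is_literal :: "('s, 'r, 'c) protocol_instance \<Rightarrow> ('s, 'r, 'c) fm \<Rightarrow> bool" where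
  "is_literal P f \<longleftrightarrow>
     (\<exists>(r, cs)\<in>state_vars P. f = Atom r (map Const cs) \<or> f = Neg (Atom r (map Const cs)))"

definition is_clause :: "('s, 'r, 'c) protocol_instance \<Rightarrow> ('s, 'r, 'c) fm \<Rightarrow> bool" where
  "is_clause P f \<longleftrightarrow> (\<exists>ls. f = Disj ls \<and> (\<forall>l\<in>set ls. is_literal P l))"

definition consts_of_sort ::
    "('s, 'r, 'c) protocol_instance \<Rightarrow> ('s, 'r, 'c) fm \<Rightarrow> 's \<Rightarrow> 'c set" where
  "consts_of_sort P f s = fm_consts f \<inter> constants P s"

definition num_consts ::
    "('s, 'r, 'c) protocol_instance \<Rightarrow> ('s, 'r, 'c) fm \<Rightarrow> 's \<Rightarrow> nat" where
  "num_consts P f s = card (consts_of_sort P f s)"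

fun subst_trm :: "('c \<Rightarrow> 'c trm) \<Rightarrow> 'c trm \<Rightarrow> 'c trm" where
  "subst_trm \<theta> (Const c) = \<theta> c"
| "subst_trm \<theta> (Var v) = Var v"

text \<open>
  Simultaneous replacement of constants by terms. Nothing is done to avoid capture; below, terms
  with variables are only substituted into quantifier-free formulas.
\<close>

fun subst :: "('c \<Rightarrow> 'c trm) \<Rightarrow> ('s, 'r, 'c) fm \<Rightarrow> ('s, 'r, 'c) fm" where
  "subst \<theta> (Atom r ts) = Atom r (map (subst_trm \<theta>) ts)"
| "subst \<theta> (Distinct ts) = Distinct (map (subst_trm \<theta>) ts)"
| "subst \<theta> (Neg f) = Neg (subst \<theta> f)"
| "subst \<theta> (Conj fs) = Conj (map (subst \<theta>) fs)"
| "subst \<theta> (Disj fs) = Disj (map (subst \<theta>) fs)"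
| "subst \<theta> (Imp f g) = Imp (subst \<theta> f) (subst \<theta> g)"
| "subst \<theta> (Forall v s f) = Forall v s (subst \<theta> f)"

text \<open>
  A permutation of the constants of \<open>s\<close> is represented by its extension that fixes every other
  element of \<open>'c\<close>, so \<open>rename \<gamma>\<close> leaves the constants of the other sorts unchanged.
\<close>

definition Sym :: "('s, 'r, 'c) protocol_instance \<Rightarrow> 's \<Rightarrow> ('c \<Rightarrow> 'c) set" where
  "Sym P s = {\<gamma>. \<gamma> permutes constants P s}"

definition rename :: "('c \<Rightarrow> 'c) \<Rightarrow> ('s, 'r, 'c) fm \<Rightarrow> ('s, 'r, 'c) fm" where
  "rename \<gamma> f = subst (\<lambda>c. Const (\<gamma> c)) f"

text \<open>
  The conjunction of all \<open>f\<^sup>\<gamma>\<close>, for \<open>\<gamma>\<close> ranging over a finite set of permutations enumerated by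
  the list \<open>\<gamma>s\<close>.
\<close>

definition orbit_conj :: "('c \<Rightarrow> 'c) list \<Rightarrow> ('s, 'r, 'c) fm \<Rightarrow> ('s, 'r, 'c) fm" where
  "orbit_conj \<gamma>s f = Conj (map (\<lambda>\<gamma>. rename \<gamma> f) \<gamma>s)"

definition abstract_consts ::
    "'c list \<Rightarrow> nat list \<Rightarrow> ('s, 'r, 'c) fm \<Rightarrow> ('s, 'r, 'c) fm" where
  "abstract_consts cs Vs f =
     subst (\<lambda>c. case map_of (zip cs Vs) c of Some v \<Rightarrow> Var v | None \<Rightarrow> Const c) f"

definition foralls :: "nat list \<Rightarrow> 's \<Rightarrow> ('s, 'r, 'c) fm \<Rightarrow> ('s, 'r, 'c) fm" where
  "foralls Vs s f = foldr (\<lambda>v. Forall v s) Vs f"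

text \<open>
  The sentence \<open>\<Phi>(s)\<close>; the list \<open>cs\<close> holds the constants \<open>c\<^sub>1, \<dots>, c\<^sub>n\<close> of sort \<open>s\<close> in \<open>f\<close>, and \<open>Vs\<close>
  the names of the variables that replace them.
\<close>

definition quantified_form ::
    "'s \<Rightarrow> 'c list \<Rightarrow> nat list \<Rightarrow> ('s, 'r, 'c) fm \<Rightarrow> ('s, 'r, 'c) fm" where
  "quantified_form s cs Vs f =
     foralls Vs s (Imp (Distinct (map Var Vs)) (abstract_consts cs Vs f))"

end

theory Submission
  imports Defs
begin

text \<open>
  An assignment of pairwise different constants of \<open>s\<close> to \<open>V\<^sub>1, \<dots>, V\<^sub>n\<close> is the same thing as an
  injection of \<open>{c\<^sub>1, \<dots>, c\<^sub>n}\<close> into the constants of \<open>s\<close>. Such injections are exactly the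
  restrictions of the permutations of the finite set of constants of \<open>s\<close>, and the truth of
  \<open>\<phi>\<^sup>\<gamma>\<close> depends only on the restriction of \<open>\<gamma>\<close> to the constants of \<open>\<phi>\<close>.
\<close>

text \<open>The arguments of a literal are all constants, so after substitution each takes the value
  of some \<theta> c under \<sigma>. Varying \<theta> and \<sigma> together allows a formula with
  variables to be compared with a renamed ground one.\<close>

lemma sat_subst_literal_cong:
  assumes "is_literal P l"
    and "\<And>c. c \<in> fm_consts l \<Longrightarrow> trm_val \<sigma> (\<theta> c) = trm_val \<sigma>' (\<theta>' c)"
  shows "sat P M \<sigma> (subst \<theta> l) \<longleftrightarrow> sat P M \<sigma>' (subst \<theta>' l)"
proof -
  from assms(1) obtain r cs
    where l: "l = Atom r (map Const cs) \<or> l = Neg (Atom r (map Const cs))"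
    unfolding is_literal_def by auto
  with assms(2) have "map (trm_val \<sigma> \<circ> \<theta>) cs = map (trm_val \<sigma>' \<circ> \<theta>') cs"
    by auto
  with l show ?thesis
    by (auto simp: comp_def cong: map_cong)
qed

lemma sat_subst_clause_cong:
  assumes "is_clause P \<phi>"
    and "\<And>c. c \<in> fm_consts \<phi> \<Longrightarrow> trm_val \<sigma> (\<theta> c) = trm_val \<sigma>' (\<theta>' c)"
  shows "sat P M \<sigma> (subst \<theta> \<phi>) \<longleftrightarrow> sat P M \<sigma>' (subst \<theta>' \<phi>)"
proof -
  from assms(1) obtain ls where \<phi>: "\<phi> = Disj ls" and ls: "\<And>l. l \<in> set ls \<Longrightarrow> is_literal P l"
    unfolding is_clause_def by auto
  have "sat P M \<sigma> (subst \<theta> l) \<longleftrightarrow> sat P M \<sigma>' (subst \<theta>' l)" if "l \<in> set ls" for l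
    using that assms(2) by (intro sat_subst_literal_cong ls) (auto simp: \<phi>)
  then show ?thesis
    by (simp add: \<phi>)
qed

text \<open>Nested updates of \<sigma> merge into a single assignment \<tau>, which turns the
  quantifier block into one quantifier over assignments.\<close>

lemma sat_foralls:
  "sat P M \<sigma> (foralls Vs s f) \<longleftrightarrow>
     (\<forall>\<tau>. (\<forall>v\<in>set Vs. \<tau> v \<in> constants P s) \<and> (\<forall>v. v \<notin> set Vs \<longrightarrow> \<tau> v = \<sigma> v) \<longrightarrow> sat P M \<tau> f)"
proof (induction Vs arbitrary: \<sigma>)
  case Nil
  have "(\<forall>v. \<tau> v = \<sigma> v) \<longleftrightarrow> \<tau> = \<sigma>" for \<tau>
    by auto
  then show ?case
    by (simp add: foralls_def)
next
  case (Cons v Vs)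
  have unfold: "sat P M \<sigma> (foralls (v # Vs) s f) \<longleftrightarrow>
      (\<forall>c\<in>constants P s. sat P M (\<sigma>(v := c)) (foralls Vs s f))"
    by (simp add: foralls_def)
  show ?case
    unfolding unfold Cons.IH
  proof (intro iffI allI ballI impI; elim conjE)
    fix \<tau>
    assume *: "\<forall>c\<in>constants P s. \<forall>\<tau>. (\<forall>v\<in>set Vs. \<tau> v \<in> constants P s) \<and>
        (\<forall>x. x \<notin> set Vs \<longrightarrow> \<tau> x = (\<sigma>(v := c)) x) \<longrightarrow> sat P M \<tau> f"
      and \<tau>: "\<forall>v\<in>set (v # Vs). \<tau> v \<in> constants P s" "\<forall>x. x \<notin> set (v # Vs) \<longrightarrow> \<tau> x = \<sigma> x"
    then show "sat P M \<tau> f"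
      by (intro *[rule_format, of "\<tau> v"]) auto
  next
    fix c \<tau>
    assume *: "\<forall>\<tau>. (\<forall>v\<in>set (v # Vs). \<tau> v \<in> constants P s) \<and>
        (\<forall>x. x \<notin> set (v # Vs) \<longrightarrow> \<tau> x = \<sigma> x) \<longrightarrow> sat P M \<tau> f"
      and c: "c \<in> constants P s"
      and \<tau>: "\<forall>v\<in>set Vs. \<tau> v \<in> constants P s" "\<forall>x. x \<notin> set Vs \<longrightarrow> \<tau> x = (\<sigma>(v := c)) x"
    \<comment> \<open>If v recurs in \<open>Vs\<close>, the inner quantifier overrides c and \<tau>
      v is still in the sort; otherwise \<tau> v = c.\<close>
    then have "\<tau> v \<in> constants P s"
      by (cases "v \<in> set Vs") auto
    with \<tau> show "sat P M \<tau> f"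
      by (intro *[rule_format]) auto
  qed
qed

lemma inj_on_extends_to_permutation:
  assumes "finite C" "A \<subseteq> C" "inj_on g A" "g ` A \<subseteq> C"
  obtains \<gamma> where "\<gamma> permutes C" "\<And>a. a \<in> A \<Longrightarrow> \<gamma> a = g a"
proof -
  have "card (C - A) = card (C - g ` A)"
    using assms by (simp add: card_Diff_subset card_image finite_subset)
  then obtain h where h: "bij_betw h (C - A) (C - g ` A)"
    using assms(1) by (metis finite_Diff finite_same_card_bij)
  define \<gamma> where "\<gamma> a = (if a \<in> A then g a else if a \<in> C then h a else a)" for a
  have "bij_betw \<gamma> A (g ` A)"
    using assms(3) by (auto simp: \<gamma>_def bij_betw_def inj_on_def)
  moreover have "bij_betw \<gamma> (C - A) (C - g ` A)"
    using h by (subst bij_betw_cong[of _ _ h]) (auto simp: \<gamma>_def)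
  ultimately have "bij_betw \<gamma> (A \<union> (C - A)) (g ` A \<union> (C - g ` A))"
    by (rule bij_betw_combine) auto
  then have "bij_betw \<gamma> C C"
    using assms by (simp add: Un_absorb1)
  then have "\<gamma> permutes C"
    using assms(2) by (intro bij_imp_permutes) (auto simp: \<gamma>_def)
  then show thesis
    by (rule that) (simp add: \<gamma>_def)
qed

text \<open>Turns the pairing of the c_i with the V_i into a bijection w; injectivity comes from
  \<open>map w xs = ys\<close> and \<open>distinct ys\<close>.\<close>

lemma map_of_zip_bij:
  assumes "distinct xs" "distinct ys" "length xs = length ys"
  obtains w where "bij_betw w (set xs) (set ys)" "\<And>x. x \<in> set xs \<Longrightarrow> map_of (zip xs ys) x = Some (w x)"
proof
  define w where "w = the \<circ> map_of (zip xs ys)"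
  have nth: "map_of (zip xs ys) (xs ! i) = Some (ys ! i)" if "i < length xs" for i
    using assms that by (simp add: map_of_zip_nth)
  show "map_of (zip xs ys) x = Some (w x)" if "x \<in> set xs" for x
    using that nth by (auto simp: in_set_conv_nth w_def)
  have "map w xs = ys"
    using assms(3) nth by (intro nth_equalityI) (auto simp: w_def)
  then show "bij_betw w (set xs) (set ys)"
    using assms by (metis bij_betw_def distinct_map set_map)
qed

theorem theorem2:
  fixes P :: "('s, 'r, 'c) protocol_instance"
    and s :: 's
    and \<phi> :: "('s, 'r, 'c) fm"
    and cs :: "'c list"
    and Vs :: "nat list"
    and \<gamma>s :: "('c \<Rightarrow> 'c) list"
  assumes "finite_instance P"
    and "s \<in> sorts P"
    and "is_clause P \<phi>"
    and "0 < num_consts P \<phi> s"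
    and "num_consts P \<phi> s < card (constants P s)"
    and "distinct cs" and "set cs = consts_of_sort P \<phi> s"
    and "distinct Vs" and "length Vs = num_consts P \<phi> s"
    and "distinct \<gamma>s" and "set \<gamma>s = Sym P s"
  shows "logically_equivalent P (quantified_form s cs Vs \<phi>) (orbit_conj \<gamma>s \<phi>)"
proof -
  let ?C = "constants P s"
  have fin: "finite ?C"
    using assms(1,2) by (auto simp: finite_instance_def)
  have cs: "set cs = fm_consts \<phi> \<inter> ?C"
    using assms(7) by (simp add: consts_of_sort_def)
  have "length cs = length Vs"
    using assms(6,7,9) by (metis distinct_card num_consts_def)
  with assms(6,8) obtain w where w: "bij_betw w (set cs) (set Vs)"
    and zip: "\<And>c. c \<in> set cs \<Longrightarrow> map_of (zip cs Vs) c = Some (w c)"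
    by (rule map_of_zip_bij) blast
  have zip_None: "map_of (zip cs Vs) c = None" if "c \<notin> set cs" for c
    using that \<open>length cs = length Vs\<close> by simp
  \<comment> \<open>The two assignments are unrelated outside \<open>Vs\<close>: the renamed clause
    is ground, and the abstracted one has variables only from \<open>Vs\<close>.\<close>
  have transfer: "sat P M \<tau> (abstract_consts cs Vs \<phi>) \<longleftrightarrow> sat P M \<sigma> (rename \<gamma> \<phi>)"
    if "\<gamma> permutes ?C" and "\<And>c. c \<in> set cs \<Longrightarrow> \<gamma> c = \<tau> (w c)" for M \<tau> \<sigma> \<gamma>
    unfolding abstract_consts_def rename_def
  proof (rule sat_subst_clause_cong[OF assms(3)])
    fix c
    assume "c \<in> fm_consts \<phi>"
    then show "trm_val \<tau> (case map_of (zip cs Vs) c of Some v \<Rightarrow> Var v | None \<Rightarrow> Const c) =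
        trm_val \<sigma> (Const (\<gamma> c))"
      \<comment> \<open>A constant of \<phi> missing from \<open>cs\<close> lies outside the sort,
        so \<gamma> fixes it, in agreement with the \<open>None\<close> case.\<close>
      using that cs by (cases "c \<in> set cs") (auto simp: zip zip_None permutes_not_in)
  qed
  have orbit: "sat P M \<sigma> (orbit_conj \<gamma>s \<phi>) \<longleftrightarrow> (\<forall>\<gamma>. \<gamma> permutes ?C \<longrightarrow> sat P M \<sigma> (rename \<gamma> \<phi>))" for M \<sigma>
    using assms(11) by (auto simp: orbit_conj_def Sym_def)
  have quantified: "sat P M \<sigma> (quantified_form s cs Vs \<phi>) \<longleftrightarrow>
      (\<forall>\<tau>. (\<forall>v\<in>set Vs. \<tau> v \<in> ?C) \<and> (\<forall>v. v \<notin> set Vs \<longrightarrow> \<tau> v = \<sigma> v) \<longrightarrow>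
        inj_on \<tau> (set Vs) \<longrightarrow> sat P M \<tau> (abstract_consts cs Vs \<phi>))" for M \<sigma>
    \<comment> \<open>As the names in \<open>Vs\<close> are distinct, the \<open>Distinct\<close>
      guard says exactly that \<tau> is injective on \<open>set Vs\<close>.\<close>
    using assms(8) by (simp add: quantified_form_def sat_foralls distinct_map comp_def)
  show ?thesis
    unfolding logically_equivalent_def orbit quantified
  proof (intro allI iffI impI; (elim conjE)?)
    fix M \<sigma> \<gamma>
    assume *: "\<forall>\<tau>. (\<forall>v\<in>set Vs. \<tau> v \<in> ?C) \<and> (\<forall>v. v \<notin> set Vs \<longrightarrow> \<tau> v = \<sigma> v) \<longrightarrow>
        inj_on \<tau> (set Vs) \<longrightarrow> sat P M \<tau> (abstract_consts cs Vs \<phi>)"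
      and \<gamma>: "\<gamma> permutes ?C"
    \<comment> \<open>The instance of the quantifiers that yields \<gamma> sends each V_i to
      \<gamma> c_i, where u recovers c_i from V_i.\<close>
    define u where "u = inv_into (set cs) w"
    define \<tau> where "\<tau> v = (if v \<in> set Vs then \<gamma> (u v) else \<sigma> v)" for v
    have u: "bij_betw u (set Vs) (set cs)"
      unfolding u_def using w by (rule bij_betw_inv_into)
    have "\<tau> v \<in> ?C" if "v \<in> set Vs" for v
      using that bij_betwE[OF u] cs permutes_in_image[OF \<gamma>] by (auto simp: \<tau>_def)
    moreover have "inj_on \<tau> (set Vs)"
      using u permutes_inj[OF \<gamma>] by (auto simp: \<tau>_def bij_betw_def inj_on_def)
    ultimately have "sat P M \<tau> (abstract_consts cs Vs \<phi>)"
      by (intro *[rule_format]) (auto simp: \<tau>_def)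
    moreover have "\<gamma> c = \<tau> (w c)" if "c \<in> set cs" for c
      using that w bij_betwE[OF w] by (auto simp: \<tau>_def u_def bij_betw_inv_into_left)
    ultimately show "sat P M \<sigma> (rename \<gamma> \<phi>)"
      using transfer[OF \<gamma>] by blast
  next
    fix M \<sigma> \<tau>
    assume *: "\<forall>\<gamma>. \<gamma> permutes ?C \<longrightarrow> sat P M \<sigma> (rename \<gamma> \<phi>)"
      and \<tau>: "\<forall>v\<in>set Vs. \<tau> v \<in> ?C" "inj_on \<tau> (set Vs)"
    \<comment> \<open>Conversely, \<tau> prescribes the images of the c_i only; any permutation
      extending this injection serves as \<gamma>.\<close>
    have "inj_on (\<tau> \<circ> w) (set cs)"
      using w \<tau>(2) by (metis bij_betw_def comp_inj_on)
    moreover have "(\<tau> \<circ> w) ` set cs \<subseteq> ?C"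
      using \<tau>(1) bij_betwE[OF w] by auto
    ultimately obtain \<gamma> where "\<gamma> permutes ?C" "\<And>c. c \<in> set cs \<Longrightarrow> \<gamma> c = (\<tau> \<circ> w) c"
      using inj_on_extends_to_permutation[OF fin] cs by (metis inf_le2)
    then show "sat P M \<tau> (abstract_consts cs Vs \<phi>)"
      using * transfer by (metis comp_apply)
  qed
qed

end
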